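(* Let $M$ be a uniform matroid on a finite set $V$ which is distinct from the free matroid on $V$. (a) If $N$ is a matroid on $\mathrm{Sym}_3(V)$ which satisfies the Flat Property and Multilinearity with respect to $M$ (with $k=3$), then $N$ satisfies the SP-rank Property with respect to $M$. (b) There exists a matroid $N$ on $\mathrm{Sym}_4(V)$ which satisfies the Flat Property and Multilinearity with respect to $M$ (with $k=4$), but does not satisfy the SP-rank Property with respect to $M$.
   Context: For a finite set $V$ and an integer $k\ge 0$, $\mathrm{Sym}_k(V)$ is the set of unordered $k$-words (multisets of size $k$) over $V$; $\mathrm{Sym}_0(V)=\{\emptyset\}$ (empty word) and $\mathrm{Sym}_1(V)=V$. For $\alpha\in\mathrm{Sym}_i(V)$, $\beta\in\mathrm{Sym}_j(V)$, $\alpha\cdot\beta\in\mathrm{Sym}_{i+j}(V)$ is the concatenation; $A\cdot B=\{\alpha\cdot\beta:\alpha\in A,\beta\in B\}$ and $\alpha\cdot B=\{\alpha\}\cdot B$. $L_M$ is the set of loops of $M$, $\operatorname{rank}M$ its rank, $N|_X$ the restriction of $N$ to $X$. The free matroid on $V$ is the matroid in which $V$ is independent. Properties of a matroid $N$ on $\mathrm{Sym}_k(V)$ with respect to a matroid $M$ on $V$: - SP-rank Property: $\operatorname{rank}N=\binom{\operatorname{rank}M+k-1}{k}$. - Flat Property: for every flat $F$ of $M$, $F\cdot\mathrm{Sym}_{k-1}(V)$ is a flat of $N$. - Multilinearity: for all $\tau\in\mathrm{Sym}_{k-1}(V\setminus L_M)$, $N|_{\tau\cdot V}$ is isomorphic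 to $M$ via the bijection $\tau\cdot v\mapsto v$ between $\tau\cdot V$ and $V$; and $\tau\cdot v$ is a loop of $N$ for all $\tau\in\mathrm{Sym}_{k-1}(V)$ and $v\in L_M$.
   Formalization: Part (b) is proved only for rank M ≥ 3 and |V| = rank M + 1, since for every other non-free uniform M (rank M ≤ 2, or |V| ≥ rank M + 2) the Flat Property and Multilinearity with k = 4 force the SP-rank Property, so (b) is false there. *)

theory Defs
  imports "HOL-Library.Multiset"
begin

locale matroid =
  fixes E :: "'a set" and indep :: "'a set \<Rightarrow> bool"
  assumes finite_carrier: "finite E"
    and indep_subset_carrier: "indep X \<Longrightarrow> X \<subseteq> E"
    and indep_empty: "indep {}"
    and indep_subset: "indep X \<Longrightarrow> Y \<subseteq> X \<Longrightarrow> indep Y"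
    and augment: "indep X \<Longrightarrow> indep Y \<Longrightarrow> card X < card Y
                    \<Longrightarrow> \<exists>y\<in>Y - X. indep (insert y X)"

definition rank_of :: "('a set \<Rightarrow> bool) \<Rightarrow> 'a set \<Rightarrow> nat" where
  "rank_of indep X = Max (card ` {Y. Y \<subseteq> X \<and> indep Y})"

definition matroid_rank :: "'a set \<Rightarrow> ('a set \<Rightarrow> bool) \<Rightarrow> nat" where
  "matroid_rank E indep = rank_of indep E"

definition loops :: "'a set \<Rightarrow> ('a set \<Rightarrow> bool) \<Rightarrow> 'a set" where
  "loops E indep = {e \<in> E. \<not> indep {e}}"

definition flat :: "'a set \<Rightarrow> ('a set \<Rightarrow> bool) \<Rightarrow> 'a set \<Rightarrow> bool" where
  "flat E indep F \<longleftrightarrow>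
     F \<subseteq> E \<and> (\<forall>e\<in>E - F. rank_of indep F < rank_of indep (insert e F))"

definition restriction :: "('a set \<Rightarrow> bool) \<Rightarrow> 'a set \<Rightarrow> 'a set \<Rightarrow> bool" where
  "restriction indep X = (\<lambda>Y. Y \<subseteq> X \<and> indep Y)"

definition matroid_iso ::
  "('a \<Rightarrow> 'b) \<Rightarrow> 'a set \<Rightarrow> ('a set \<Rightarrow> bool) \<Rightarrow> 'b set \<Rightarrow> ('b set \<Rightarrow> bool) \<Rightarrow> bool" where
  "matroid_iso f E indep E' indep' \<longleftrightarrow>
     bij_betw f E E' \<and> (\<forall>X\<subseteq>E. indep X \<longleftrightarrow> indep' (f ` X))"

definition uniform_matroid :: "'a set \<Rightarrow> ('a set \<Rightarrow> bool) \<Rightarrow> bool" where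
  "uniform_matroid E indep \<longleftrightarrow>
     matroid E indep \<and> (\<exists>r. \<forall>X. indep X \<longleftrightarrow> X \<subseteq> E \<and> card X \<le> r)"

definition free_matroid :: "'a set \<Rightarrow> ('a set \<Rightarrow> bool) \<Rightarrow> bool" where
  "free_matroid E indep \<longleftrightarrow> matroid E indep \<and> indep E"

definition Sym :: "nat \<Rightarrow> 'a set \<Rightarrow> 'a multiset set" where
  "Sym k V = {\<alpha>. size \<alpha> = k \<and> set_mset \<alpha> \<subseteq> V}"

text \<open>Concatenation of unordered words is the sum of multisets; \<open>words1 F\<close> is a set of letters
  \<open>F \<subseteq> V\<close> viewed inside \<open>Sym 1 V\<close>.\<close>

definition words1 :: "'a set \<Rightarrow> 'a multiset set" where
  "words1 F = (\<lambda>v. {#v#}) ` F"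

definition concat_words :: "'a multiset set \<Rightarrow> 'a multiset set \<Rightarrow> 'a multiset set" where
  "concat_words A B = {\<alpha> + \<beta> | \<alpha> \<beta>. \<alpha> \<in> A \<and> \<beta> \<in> B}"

text \<open>In the following properties \<open>M\<close> is the independence predicate of a matroid on \<open>V\<close> and
  \<open>N\<close> that of a matroid on \<open>Sym k V\<close>, with \<open>k \<ge> 1\<close> (so that the truncated subtractions on
  \<open>nat\<close> are exact).\<close>

definition SP_rank_property ::
  "nat \<Rightarrow> 'a set \<Rightarrow> ('a set \<Rightarrow> bool) \<Rightarrow> ('a multiset set \<Rightarrow> bool) \<Rightarrow> bool" where
  "SP_rank_property k V M N \<longleftrightarrow>
     matroid_rank (Sym k V) N = (matroid_rank V M + k - 1) choose k"

definition flat_property ::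
  "nat \<Rightarrow> 'a set \<Rightarrow> ('a set \<Rightarrow> bool) \<Rightarrow> ('a multiset set \<Rightarrow> bool) \<Rightarrow> bool" where
  "flat_property k V M N \<longleftrightarrow>
     (\<forall>F. flat V M F \<longrightarrow> flat (Sym k V) N (concat_words (words1 F) (Sym (k - 1) V)))"

text \<open>\<open>the_inv_into V (\<lambda>v. \<tau> + {#v#})\<close> is the map \<open>\<tau> \<cdot> v \<mapsto> v\<close> from \<open>\<tau> \<cdot> V\<close> to \<open>V\<close>.\<close>

definition multilinearity ::
  "nat \<Rightarrow> 'a set \<Rightarrow> ('a set \<Rightarrow> bool) \<Rightarrow> ('a multiset set \<Rightarrow> bool) \<Rightarrow> bool" where
  "multilinearity k V M N \<longleftrightarrow>
     (\<forall>\<tau> \<in> Sym (k - 1) (V - loops V M).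
        matroid_iso (the_inv_into V (\<lambda>v. \<tau> + {#v#}))
          (concat_words {\<tau>} (words1 V)) (restriction N (concat_words {\<tau>} (words1 V))) V M) \<and>
     (\<forall>\<tau> \<in> Sym (k - 1) V. \<forall>v \<in> loops V M. \<tau> + {#v#} \<in> loops (Sym k V) N)"

end

theory Submission
  imports Complex_Main Defs "HOL-Library.Function_Algebras"
begin

text \<open>(a) Let \<open>B\<close> be a basis of \<open>M\<close>. By Multilinearity \<open>Sym 3 B\<close> spans \<open>N\<close>, so it remains to see that it
  is independent. Flats \<open>F \<cdot> Sym 2 V\<close> separate every word of \<open>Sym 3 B\<close> from the others, except
  that they do not separate \<open>a\<^sup>2b\<close> from \<open>ab\<^sup>2\<close>; this is done with a letter outside \<open>B\<close>, which
  exists as \<open>M\<close> is not free, through the circuits contained in \<open>ab \<cdot> V\<close>.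

  (b) Evaluating words as monomials on the hyperplane \<open>\<Sum>x\<^sub>v = 0\<close> gives a representable matroid
  with all three properties. Restricting the monomials to the zeros of \<open>x\<^sub>a\<^sup>3x\<^sub>b - x\<^sub>ax\<^sub>b\<^sup>3\<close> makes
  \<open>a\<^sup>3b\<close> and \<open>ab\<^sup>3\<close> parallel and thus lowers the rank. The Flat Property survives because
  the zero set has a point with every support of size at least two, and Multilinearity because
  its points with full support span the hyperplane.\<close>

subsection \<open>Closure in a matroid\<close>

context matroid
begin

section \<open>Rank through maximal independent sets\<close>

lemma finite_indep_sizes: "X \<subseteq> E \<Longrightarrow> finite (card ` {Y. Y \<subseteq> X \<and> indep Y})"
  by (rule finite_imageI, rule finite_subset[of _ "Pow X"])
     (auto dest: finite_subset[OF _ finite_carrier])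

lemma finite_indep: "indep X \<Longrightarrow> finite X"
  using indep_subset_carrier finite_carrier finite_subset by blast

lemma card_le_rank_of: "X \<subseteq> E \<Longrightarrow> Y \<subseteq> X \<Longrightarrow> indep Y \<Longrightarrow> card Y \<le> rank_of indep X"
  unfolding rank_of_def by (rule Max_ge[OF finite_indep_sizes]) auto

lemma obtain_basis:
  assumes "X \<subseteq> E"
  obtains I where "I \<subseteq> X" "indep I" "card I = rank_of indep X"
proof -
  have "rank_of indep X \<in> card ` {Y. Y \<subseteq> X \<and> indep Y}"
    unfolding rank_of_def using indep_empty
    by (intro Max_in finite_indep_sizes assms) auto
  then show thesis using that by auto
qed

text \<open>Otherwise augmentation from a larger independent subset of \<open>X\<close> would extend
  \<open>I\<close> inside \<open>X\<close>.\<close>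

lemma card_eq_rank_of_if_maximal:
  assumes "X \<subseteq> E" "I \<subseteq> X" "indep I" and max: "\<And>x. x \<in> X - I \<Longrightarrow> \<not> indep (insert x I)"
  shows "card I = rank_of indep X"
proof (rule ccontr)
  assume "card I \<noteq> rank_of indep X"
  moreover have "card I \<le> rank_of indep X" using assms card_le_rank_of by blast
  moreover obtain J where J: "J \<subseteq> X" "indep J" "card J = rank_of indep X"
    using obtain_basis assms(1) by blast
  ultimately obtain y where "y \<in> J - I" "indep (insert y I)"
    using augment[of I J] assms(3) by auto
  then show False using max J by blast
qed

section \<open>The closure operator: monotonicity, idempotence, exchange\<close>

definition cl :: "'a set \<Rightarrow> 'a set" where
  "cl A = {e \<in> E. rank_of indep (insert e A) = rank_of indep A}"

lemma cl_subset_carrier: "cl A \<subseteq> E"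
  by (auto simp: cl_def)

text \<open>If \<open>e\<close> does not extend \<open>I\<close>, then \<open>I\<close> is still
  maximal in \<open>insert e A\<close>, so the rank is unchanged. Closures can be computed from any
  one basis.\<close>

lemma cl_basis:
  assumes "A \<subseteq> E" "I \<subseteq> A" "indep I" and card: "card I = rank_of indep A"
  shows "cl A = {e \<in> E. e \<in> I \<or> \<not> indep (insert e I)}"
proof (intro set_eqI iffI)
  fix e assume e: "e \<in> cl A"
  show "e \<in> {e \<in> E. e \<in> I \<or> \<not> indep (insert e I)}"
  proof (rule ccontr)
    assume "\<not> ?thesis"
    then have "e \<notin> I" "indep (insert e I)" "e \<in> E" using e by (auto simp: cl_def)
    then have "card (insert e I) \<le> rank_of indep (insert e A)"
      using card_le_rank_of[of "insert e A" "insert e I"] assms by auto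
    then show False using e \<open>e \<notin> I\<close> finite_indep[OF assms(3)] card by (simp add: cl_def)
  qed
next
  fix e assume e: "e \<in> {e \<in> E. e \<in> I \<or> \<not> indep (insert e I)}"
  have max: "\<not> indep (insert x I)" if x: "x \<in> A - I" for x
  proof
    assume "indep (insert x I)"
    then have "card (insert x I) \<le> rank_of indep A"
      using x assms card_le_rank_of[of A "insert x I"] by auto
    then show False using x finite_indep[OF assms(3)] card by simp
  qed
  have "card I = rank_of indep (insert e A)"
    by (rule card_eq_rank_of_if_maximal) (use e assms max in auto)
  then show "e \<in> cl A" using e card by (simp add: cl_def)
qed

lemma basis_if_maximal_cl:
  assumes "A \<subseteq> E" "I \<subseteq> A" "indep I" "card I = rank_of indep A" "X \<subseteq> cl A"
  shows "card I = rank_of indep (A \<union> X)"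
proof (rule card_eq_rank_of_if_maximal)
  show "A \<union> X \<subseteq> E" using assms cl_subset_carrier by blast
  have "A \<subseteq> cl A" using assms(1) by (auto simp: cl_def insert_absorb)
  then show "\<not> indep (insert x I)" if "x \<in> A \<union> X - I" for x
    using that cl_basis[OF assms(1-4)] assms(5) by auto
qed (use assms in auto)

lemma subset_cl: "A \<subseteq> E \<Longrightarrow> A \<subseteq> cl A"
  by (auto simp: cl_def insert_absorb)

text \<open>A basis of \<open>A\<close> grows to a basis of \<open>B\<close>, and dependence on the
  smaller one persists.\<close>

lemma cl_mono:
  assumes "A \<subseteq> B" "B \<subseteq> E"
  shows "cl A \<subseteq> cl B"
proof
  fix e assume e: "e \<in> cl A"
  have A: "A \<subseteq> E" using assms by auto
  obtain I where I: "I \<subseteq> A" "indep I" "card I = rank_of indep A"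
    using obtain_basis[OF A] .
  have "\<exists>J. I \<subseteq> J \<and> J \<subseteq> B \<and> indep J \<and> card J = rank_of indep B"
  proof -
    let ?S = "{J. I \<subseteq> J \<and> J \<subseteq> B \<and> indep J}"
    have "finite ?S" using finite_subset[OF assms(2) finite_carrier]
      by (auto intro: finite_subset[of _ "Pow B"])
    moreover have "I \<in> ?S" using I assms by auto
    ultimately obtain J where J: "J \<in> ?S" and max: "\<And>K. K \<in> ?S \<Longrightarrow> J \<subseteq> K \<Longrightarrow> J = K"
      using finite_has_maximal[of ?S] by (metis (no_types, lifting) empty_iff)
    have "card J = rank_of indep B"
      by (rule card_eq_rank_of_if_maximal) (use J assms max[of "insert _ J"] in auto)
    then show ?thesis using J by auto
  qed
  then obtain J where J: "I \<subseteq> J" "J \<subseteq> B" "indep J" "card J = rank_of indep B" by blast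
  have "e \<in> I \<or> \<not> indep (insert e I)" "e \<in> E" using e cl_basis[OF A I] by auto
  then have "e \<in> J \<or> \<not> indep (insert e J)"
    using J(1) indep_subset[of "insert e J" "insert e I"] by auto
  then show "e \<in> cl B" using cl_basis[OF assms(2) J(2-4)] \<open>e \<in> E\<close> by auto
qed

lemma cl_Un_eq:
  assumes "A \<subseteq> E" "X \<subseteq> cl A"
  shows "rank_of indep (A \<union> X) = rank_of indep A" "cl (A \<union> X) = cl A"
proof -
  obtain I where I: "I \<subseteq> A" "indep I" "card I = rank_of indep A"
    using obtain_basis[OF assms(1)] .
  have r: "card I = rank_of indep (A \<union> X)" using basis_if_maximal_cl assms I by blast
  then show "rank_of indep (A \<union> X) = rank_of indep A" using I by simp
  have "A \<union> X \<subseteq> E" using assms cl_subset_carrier by blast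
  then show "cl (A \<union> X) = cl A"
    using cl_basis[of "A \<union> X" I] cl_basis[of A I] I r assms by auto
qed

lemma cl_subsetI:
  assumes "A \<subseteq> E" "X \<subseteq> cl A"
  shows "cl X \<subseteq> cl A"
  using cl_mono[of X "A \<union> X"] cl_Un_eq[OF assms] assms cl_subset_carrier by blast

text \<open>Both elements extend a basis \<open>I\<close> of \<open>A\<close>; what remains is the
  dependence of \<open>I\<close> with both added, which is symmetric in \<open>e\<close> and
  \<open>f\<close>.\<close>

lemma cl_exchange:
  assumes A: "A \<subseteq> E" "f \<in> E" and e: "e \<in> cl (insert f A)" "e \<notin> cl A"
  shows "f \<in> cl (insert e A)"
proof -
  obtain I where I: "I \<subseteq> A" "indep I" "card I = rank_of indep A"
    using obtain_basis[OF A(1)] .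
  have cases: "card (insert x I) = rank_of indep (insert x A) \<and> indep (insert x I)"
    if "x \<in> E" "x \<notin> cl A" for x
  proof -
    have x: "x \<notin> I" "indep (insert x I)" using that cl_basis[OF A(1) I] by auto
    have "card (insert x I) = rank_of indep (insert x A)"
    proof (rule card_eq_rank_of_if_maximal)
      show "\<not> indep (insert y (insert x I))" if "y \<in> insert x A - insert x I" for y
      proof -
        have "\<not> indep (insert y I)"
          using that subset_cl[OF A(1)] cl_basis[OF A(1) I] by auto
        then show ?thesis using indep_subset[of "insert y (insert x I)" "insert y I"] by auto
      qed
    qed (use that A I x in auto)
    then show ?thesis using x by simp
  qed
  have eE: "e \<in> E" using e cl_subset_carrier by blast
  have "f \<notin> cl A"
  proof
    assume "f \<in> cl A"
    then have "cl (insert f A) \<subseteq> cl A"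
      using cl_subsetI[of A "insert f A"] subset_cl A by blast
    then show False using e by blast
  qed
  note f = cases[OF A(2) this] and ee = cases[OF eE e(2)]
  have "e \<in> insert f I \<or> \<not> indep (insert e (insert f I))"
    using e(1) cl_basis[of "insert f A" "insert f I"] f I A by blast
  moreover have "e \<notin> I" using e(2) I subset_cl[OF A(1)] by blast
  ultimately have "f \<in> insert e I \<or> \<not> indep (insert f (insert e I))"
    by (auto simp: insert_commute)
  moreover have "cl (insert e A) = {x \<in> E. x \<in> insert e I \<or> \<not> indep (insert x (insert e I))}"
    by (rule cl_basis) (use ee I A eE in auto)
  ultimately show ?thesis using A(2) by blast
qed

section \<open>Independence and flats in terms of closure\<close>

lemma card_eq_rank_of_indep: "indep I \<Longrightarrow> card I = rank_of indep I"
  by (rule card_eq_rank_of_if_maximal) (auto dest: indep_subset_carrier)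

lemma cl_indep: "indep I \<Longrightarrow> cl I = {e \<in> E. e \<in> I \<or> \<not> indep (insert e I)}"
  by (rule cl_basis) (auto dest: indep_subset_carrier card_eq_rank_of_indep)

lemma indep_insertI: "indep I \<Longrightarrow> e \<in> E \<Longrightarrow> e \<notin> cl I \<Longrightarrow> indep (insert e I)"
  by (auto simp: cl_indep)

text \<open>Elements of \<open>X\<close> are added one by one. The closure condition concerns
  \<open>X\<close> only, so independent sets can be built in layers.\<close>

lemma indep_UnI:
  assumes "indep I" "X \<subseteq> E" and "\<And>x. x \<in> X \<Longrightarrow> x \<notin> cl (I \<union> X - {x})"
  shows "indep (I \<union> X)"
proof -
  have "finite X" using assms(2) finite_carrier finite_subset by blast
  moreover have "indep (I \<union> Y)" if "finite Y" "Y \<subseteq> X" for Y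
    using that
  proof (induction Y)
    case empty then show ?case using assms(1) by simp
  next
    case (insert x Y)
    show ?case
    proof (cases "x \<in> I")
      case True then show ?thesis using insert by (simp add: insert_absorb)
    next
      case False
      have "cl (I \<union> Y) \<subseteq> cl (I \<union> X - {x})"
        using insert False assms indep_subset_carrier[OF assms(1)] by (intro cl_mono) auto
      then have "indep (insert x (I \<union> Y))" using insert assms by (intro indep_insertI) auto
      then show ?thesis by simp
    qed
  qed
  ultimately show ?thesis by blast
qed

lemma rank_of_spanning:
  assumes "S \<subseteq> E" "E \<subseteq> cl S"
  shows "rank_of indep E = rank_of indep S"
proof -
  have "S \<union> E = E" using assms(1) by blast
  then show ?thesis using cl_Un_eq(1)[of S E] assms by simp
qed

lemma rank_of_less_card:
  assumes "X \<subseteq> E" "\<not> indep X"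
  shows "rank_of indep X < card X"
proof -
  obtain I where I: "I \<subseteq> X" "indep I" "card I = rank_of indep X" using obtain_basis[OF assms(1)] .
  then have "I \<subset> X" using assms(2) by blast
  then show ?thesis
    using psubset_card_mono[of X I] I finite_subset[OF assms(1) finite_carrier] by simp
qed

lemma flat_cl_subset: "flat E indep F \<Longrightarrow> cl F \<subseteq> F"
  by (force simp: flat_def cl_def)

text \<open>The form in which the Flat Property is used: a flat bounds the closure of all its
  subsets.\<close>

lemma cl_subset_flat: "flat E indep F \<Longrightarrow> A \<subseteq> F \<Longrightarrow> cl A \<subseteq> F"
  using cl_mono[of A F] flat_cl_subset[of F] by (auto simp: flat_def)

lemma indep_flatI:
  assumes "indep F" "\<And>e. e \<in> E - F \<Longrightarrow> indep (insert e F)"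
  shows "flat E indep F"
  using assms indep_subset_carrier[OF assms(1)] finite_indep[OF assms(1)]
  by (auto simp: flat_def card_eq_rank_of_indep[symmetric])

end

subsection \<open>Spanning words\<close>

lemma Sym_eq_multisets_of_size: "Sym k V = multisets_of_size V k"
  by (auto simp: Sym_def multisets_of_size_def)

lemma Sym_mono: "V \<subseteq> W \<Longrightarrow> Sym k V \<subseteq> Sym k W"
  by (auto simp: Sym_def)

lemma finite_Sym: "finite V \<Longrightarrow> finite (Sym k V)"
  by (simp add: Sym_eq_multisets_of_size finite_multisets_of_size)

lemma card_Sym: "finite V \<Longrightarrow> card (Sym k V) = (card V + k - 1) choose k"
  by (simp add: Sym_eq_multisets_of_size card_multisets_of_size)

lemma add_mset_in_Sym: "add_mset v \<tau> \<in> Sym (Suc k) V \<longleftrightarrow> v \<in> V \<and> \<tau> \<in> Sym k V"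
  by (auto simp: Sym_def)

lemma Sym_3E:
  assumes "\<alpha> \<in> Sym 3 V"
  obtains x y z where "\<alpha> = {#x, y, z#}" "x \<in> V" "y \<in> V" "z \<in> V"
proof -
  have "size \<alpha> = Suc (Suc (Suc 0))" using assms by (simp add: Sym_def)
  then obtain x \<beta> where \<alpha>: "\<alpha> = add_mset x \<beta>" "size \<beta> = Suc (Suc 0)"
    using size_eq_Suc_imp_eq_union[of \<alpha> "Suc (Suc 0)"] by auto
  then obtain y \<gamma> where \<beta>: "\<beta> = add_mset y \<gamma>" "size \<gamma> = 1"
    using size_eq_Suc_imp_eq_union[of \<beta> "Suc 0"] by auto
  then obtain z where "\<gamma> = {#z#}" using size_1_singleton_mset by blast
  then show thesis using that[of x y z] \<alpha> \<beta> assms by (simp add: Sym_def)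
qed

lemma concat_words_words1: "concat_words {\<tau>} (words1 X) = (\<lambda>v. add_mset v \<tau>) ` X"
  by (auto simp: concat_words_def words1_def)

text \<open>Any letter of \<open>F\<close> in a word can be split off as first factor; the support
  form shows which words a flat misses.\<close>

lemma concat_words1_Sym:
  assumes "F \<subseteq> V"
  shows "concat_words (words1 F) (Sym k V) = {\<alpha> \<in> Sym (Suc k) V. set_mset \<alpha> \<inter> F \<noteq> {}}"
proof (intro set_eqI iffI)
  fix \<alpha> assume "\<alpha> \<in> {\<alpha> \<in> Sym (Suc k) V. set_mset \<alpha> \<inter> F \<noteq> {}}"
  then obtain v where v: "v \<in># \<alpha>" "v \<in> F" "\<alpha> \<in> Sym (Suc k) V" by auto
  obtain \<beta> where "\<alpha> = add_mset v \<beta>" using multi_member_split[OF v(1)] by blast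
  then show "\<alpha> \<in> concat_words (words1 F) (Sym k V)"
    using v by (force simp: concat_words_def words1_def add_mset_in_Sym)
qed (use assms in \<open>auto simp: concat_words_def words1_def add_mset_in_Sym\<close>)

text \<open>Appending a letter to \<open>\<tau>\<close> is injective, so bijectivity is automatic
  and only transfer of independence remains.\<close>

lemma matroid_iso_restriction:
  fixes \<tau> :: "'a multiset"
  shows "matroid_iso (the_inv_into V (\<lambda>v. \<tau> + {#v#})) (concat_words {\<tau>} (words1 V))
      (restriction N (concat_words {\<tau>} (words1 V))) V M
    \<longleftrightarrow> (\<forall>Y\<subseteq>V. N ((\<lambda>v. add_mset v \<tau>) ` Y) \<longleftrightarrow> M Y)"
proof -
  let ?f = "\<lambda>v. add_mset v \<tau>"
  have inj: "inj_on ?f X" for X by (auto simp: inj_on_def)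
  have "bij_betw (the_inv_into V ?f) (?f ` V) V"
    by (intro bij_betw_the_inv_into inj_on_imp_bij_betw inj)
  moreover have "the_inv_into V ?f ` (?f ` Y) = Y" if "Y \<subseteq> V" for Y
    using that by (force simp: image_image the_inv_into_f_f[OF inj])
  then have "(\<forall>X\<subseteq>?f ` V. (X \<subseteq> ?f ` V \<and> N X) = M (the_inv_into V ?f ` X)) \<longleftrightarrow>
      (\<forall>Y\<subseteq>V. N (?f ` Y) = M Y)"
    unfolding all_subset_image by (auto simp: image_mono)
  ultimately show ?thesis
    unfolding matroid_iso_def restriction_def concat_words_words1 by simp
qed

lemma multilinearity_iff:
  assumes "0 < k"
  shows "multilinearity k V M N \<longleftrightarrow>
    (\<forall>\<tau>\<in>Sym (k - 1) (V - loops V M). \<forall>Y\<subseteq>V. N ((\<lambda>v. add_mset v \<tau>) ` Y) \<longleftrightarrow> M Y) \<and>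
    (\<forall>\<tau>\<in>Sym (k - 1) V. \<forall>v\<in>loops V M. \<not> N {add_mset v \<tau>})"
proof -
  obtain j where "k = Suc j" using assms by (cases k) auto
  then show ?thesis
    unfolding multilinearity_def matroid_iso_restriction
    by (auto simp: loops_def add_mset_in_Sym)
qed

text \<open>Induction on the number of letters outside \<open>B\<close>: such a letter depends on
  \<open>B\<close> in \<open>M\<close>, and Multilinearity carries this over to words with one
  outside letter fewer.\<close>

lemma Sym_basis_spanning:
  assumes N: "matroid (Sym k V) N" and "0 < k" and mult: "multilinearity k V M N"
    and B: "B \<subseteq> V" "M B" "\<And>v. v \<in> V - B \<Longrightarrow> \<not> M (insert v B)"
    and \<alpha>: "\<alpha> \<in> Sym k V"
  shows "\<alpha> \<in> matroid.cl (Sym k V) N (Sym k B)"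
proof -
  interpret N: matroid "Sym k V" N by fact
  note mult = mult[unfolded multilinearity_iff[OF \<open>0 < k\<close>]]
  obtain j where k: "k = Suc j" using \<open>0 < k\<close> by (cases k) auto
  have S: "Sym k B \<subseteq> Sym k V" using B Sym_mono by blast
  show ?thesis using \<alpha>
  proof (induction "size (filter_mset (\<lambda>v. v \<notin> B) \<alpha>)" arbitrary: \<alpha> rule: less_induct)
    case less
    consider "\<alpha> \<in> Sym k B" | v where "v \<in># \<alpha>" "v \<in> loops V M"
      | v where "v \<in># \<alpha>" "v \<in> V - B" "set_mset \<alpha> \<inter> loops V M = {}"
      using less.prems unfolding Sym_def by fast
    then show ?case
    proof cases
      case 1
      then show ?thesis using N.subset_cl[OF S] by blast
    next
      \<comment> \<open>Multilinearity provides the isomorphism only for loop-free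
        \<open>\<tau>\<close>; a word with a loop is a loop of \<open>N\<close>.\<close>
      case (2 v)
      obtain \<tau> where \<tau>: "\<alpha> = add_mset v \<tau>" using multi_member_split[OF 2(1)] by blast
      then have "\<not> N {\<alpha>}" using mult 2 less.prems by (auto simp: k add_mset_in_Sym)
      then have "\<alpha> \<in> N.cl {}" using N.cl_indep[OF N.indep_empty] less.prems by auto
      then show ?thesis using N.cl_mono[of "{}" "Sym k B"] S by blast
    next
      case (3 v)
      obtain \<tau> where \<tau>: "\<alpha> = add_mset v \<tau>" using multi_member_split[OF 3(1)] by blast
      have "\<tau> \<in> Sym (k - 1) (V - loops V M)" using 3(3) less.prems \<tau> by (auto simp: Sym_def k)
      then have iso: "N ((\<lambda>v. add_mset v \<tau>) ` Y) \<longleftrightarrow> M Y" if "Y \<subseteq> V" for Y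
        using mult that by blast
      let ?I = "(\<lambda>v. add_mset v \<tau>) ` B"
      have "N ?I" using iso B by blast
      moreover have "\<not> N (insert \<alpha> ?I)"
        using iso[of "insert v B"] B 3(2) \<tau> by auto
      ultimately have "\<alpha> \<in> N.cl ?I" using N.cl_indep less.prems by blast
      moreover have "?I \<subseteq> N.cl (Sym k B)"
      proof
        fix \<beta> assume "\<beta> \<in> ?I"
        then obtain b where b: "b \<in> B" "\<beta> = add_mset b \<tau>" by blast
        then show "\<beta> \<in> N.cl (Sym k B)"
          using less.hyps[of \<beta>] less.prems 3(2) B(1) unfolding \<tau> k by (auto simp: add_mset_in_Sym)
      qed
      ultimately show ?thesis using N.cl_subsetI[OF S] by blast
    qed
  qed
qed

text \<open>For a basis \<open>B\<close> of \<open>M\<close>, \<open>card (Sym k B)\<close> is the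
  SP-rank, so the SP-rank Property amounts to independence of \<open>Sym k B\<close>. Both parts of
  the theorem go through this.\<close>

lemma rank_eq_rank_of_Sym_basis:
  assumes N: "matroid (Sym k V) N" and "0 < k" and mult: "multilinearity k V M N"
    and B: "B \<subseteq> V" "M B" "\<And>v. v \<in> V - B \<Longrightarrow> \<not> M (insert v B)"
  shows "matroid_rank (Sym k V) N = rank_of N (Sym k B)"
proof -
  interpret N: matroid "Sym k V" N by fact
  show ?thesis unfolding matroid_rank_def
    using Sym_basis_spanning[OF assms] Sym_mono[OF B(1)] by (intro N.rank_of_spanning) auto
qed

subsection \<open>Uniform matroids and cubic words\<close>

context
  fixes V :: "'a set" and M :: "'a set \<Rightarrow> bool" and r :: nat
  assumes finite_V: "finite V"
    and uniform: "\<And>X. M X \<longleftrightarrow> X \<subseteq> V \<and> card X \<le> r"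
begin

section \<open>Flats and rank of a uniform matroid\<close>

lemma uniform_matroid_axioms: "matroid V M"
proof
  fix X Y assume *: "M X" "M Y" "card X < card Y"
  then have "finite X" using uniform finite_V finite_subset by blast
  then have "\<not> Y \<subseteq> X" using *(3) card_mono[of X Y] by auto
  then obtain y where "y \<in> Y - X" by blast
  then show "\<exists>y\<in>Y - X. M (insert y X)"
    using * uniform \<open>finite X\<close> by (intro bexI[of _ y]) auto
next
  fix X Y assume "M X" "Y \<subseteq> X"
  then show "M Y" using card_mono[of X Y] finite_subset[OF _ finite_V] by (auto simp: uniform)
qed (use finite_V uniform in auto)

lemma uniform_loops: "0 < r \<Longrightarrow> loops V M = {}"
  by (auto simp: loops_def uniform)

lemma uniform_flatI: "F \<subseteq> V \<Longrightarrow> card F < r \<Longrightarrow> flat V M F"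
  by (rule matroid.indep_flatI[OF uniform_matroid_axioms])
     (auto simp: uniform card_insert_if finite_subset[OF _ finite_V])

text \<open>A set with \<open>r\<close> elements or more has rank \<open>r\<close> already, the
  largest possible, so nothing outside it could raise the rank.\<close>

lemma uniform_flatD:
  assumes "flat V M F"
  shows "F = V \<or> F \<subseteq> V \<and> card F < r"
proof (rule ccontr)
  interpret M: matroid V M by (rule uniform_matroid_axioms)
  assume *: "\<not> ?thesis"
  have "F \<subseteq> V" using assms by (simp add: flat_def)
  then obtain e where e: "e \<in> V - F" "r \<le> card F" using * by auto
  obtain I where I: "I \<subseteq> F" "card I = r"
    using obtain_subset_with_card_n[OF e(2)] by blast
  then have "r \<le> rank_of M F"
    using M.card_le_rank_of[OF \<open>F \<subseteq> V\<close> I(1)] uniform \<open>F \<subseteq> V\<close> by auto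
  moreover obtain J where "M J" "card J = rank_of M (insert e F)"
    using M.obtain_basis[of "insert e F"] e \<open>F \<subseteq> V\<close> by blast
  then have "rank_of M (insert e F) \<le> r" using uniform by metis
  moreover have "rank_of M F < rank_of M (insert e F)" using assms e(1) by (simp add: flat_def)
  ultimately show False by linarith
qed

lemma uniform_matroid_rank:
  assumes "B \<subseteq> V" "card B = r"
  shows "matroid_rank V M = r"
proof -
  have "\<not> M (insert x B)" if "x \<in> V - B" for x
    using that assms uniform finite_subset[OF assms(1) finite_V] by auto
  then show ?thesis unfolding matroid_rank_def
    using matroid.card_eq_rank_of_if_maximal[OF uniform_matroid_axioms, of V B] assms uniform
    by auto
qed

text \<open>For a word with support \<open>S\<close>, the flat \<open>B - S\<close> has fewer than
  \<open>r\<close> elements and meets every word over \<open>B\<close> not supported in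
  \<open>S\<close>; hence the treatment by supports.\<close>

lemma uniform_cubic_lower_bound:
  assumes N: "matroid (Sym 3 V) N" and flat: "flat_property 3 V M N"
    and mult: "multilinearity 3 V M N" and B: "B \<subseteq> V" "card B = r" and r: "r < card V"
  shows "N (Sym 3 B)"
proof -
  interpret N: matroid "Sym 3 V" N by fact
  have finB: "finite B" using B(1) finite_V finite_subset by blast
  define W where "W F = {\<alpha> \<in> Sym 3 V. set_mset \<alpha> \<inter> F \<noteq> {}}" for F
  have W: "N.cl A \<subseteq> W F" if "F \<subseteq> V" "card F < r" "A \<subseteq> W F" for F A
  proof -
    have "flat (Sym 3 V) N (concat_words (words1 F) (Sym (3 - 1) V))"
      using flat uniform_flatI[OF that(1,2)] unfolding flat_property_def by blast
    then have "flat (Sym 3 V) N (W F)"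
      using concat_words1_Sym[OF that(1), of 2] by (simp add: W_def)
    then show ?thesis using N.cl_subset_flat that(3) by blast
  qed
  have SBV: "Sym 3 B \<subseteq> Sym 3 V" by (rule Sym_mono[OF B(1)])
  have in3: "{#x, y, z#} \<in> Sym 3 X \<longleftrightarrow> x \<in> X \<and> y \<in> X \<and> z \<in> X" for x y z and X :: "'a set"
    by (auto simp: Sym_def)
  have key: "{#a, a, b#} \<notin> N.cl (insert {#a, b, b#} (W F))"
    if F: "F \<subseteq> V" "card F + 2 = r" and ab: "a \<in> V - F" "b \<in> V - F" "a \<noteq> b" for a b F
    \<comment> \<open>Otherwise, for \<open>c\<close> outside \<open>F \<union> {a, b}\<close>, the words \<open>a\<^sup>2b\<close>, \<open>ab\<^sup>2\<close> and \<open>abc\<close> are parallel modulo \<open>W F\<close>,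
      so \<open>ab\<^sup>2\<close> lies in the flat \<open>W (F \<union> {c})\<close>, which it does not meet.\<close>
  proof
    assume aab: "{#a, a, b#} \<in> N.cl (insert {#a, b, b#} (W F))"
    let ?S = "insert {#a, b, b#} (W F)" and ?G = "insert a (insert b F)"
    have finF: "finite F" using F finite_V finite_subset by blast
    have cardG: "card ?G = r" using finF ab F(2) by simp
    have GV: "?G \<subseteq> V" using F ab by auto
    \<comment> \<open>This is where \<open>M\<close> not being free enters: \<open>?G\<close> has
      only \<open>r\<close> elements.\<close>
    have "\<not> V \<subseteq> ?G" using card_mono[of ?G V] finF cardG r by auto
    then obtain c where c: "c \<in> V" "c \<notin> ?G" by blast
    have SV: "?S \<subseteq> Sym 3 V" using ab by (auto simp: W_def in3)
    have "{#a, b#} \<in> Sym (3 - 1) (V - loops V M)"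
      using ab uniform_loops F(2) by (simp add: Sym_def)
    then have iso: "N ((\<lambda>v. add_mset v {#a, b#}) ` Y) \<longleftrightarrow> M Y" if "Y \<subseteq> V" for Y
      using mult that by (simp only: multilinearity_iff[OF zero_less_numeral])
    let ?I = "(\<lambda>v. add_mset v {#a, b#}) ` ?G"
    \<comment> \<open>\<open>?G\<close> is independent in \<open>M\<close> and
      \<open>insert c ?G\<close> is not; multiplied by \<open>ab\<close>, this makes
      \<open>abc\<close> depend on \<open>ab \<cdot> ?G\<close>.\<close>
    have "N ?I" using iso[OF GV] uniform GV cardG by blast
    moreover have "\<not> N (insert {#c, a, b#} ?I)"
      using iso[of "insert c ?G"] GV c uniform cardG finF by auto
    ultimately have "{#c, a, b#} \<in> N.cl ?I"
      using N.cl_indep[of ?I] c ab by (auto simp: in3)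
    moreover have "?I \<subseteq> N.cl ?S"
    proof -
      have "{#v, a, b#} \<in> W F" if "v \<in> F" for v
        using that F ab by (auto simp: W_def in3)
      then have "(\<lambda>v. add_mset v {#a, b#}) ` F \<subseteq> N.cl ?S" using N.subset_cl[OF SV] by blast
      moreover have "{#a, b, b#} \<in> N.cl ?S" using N.subset_cl[OF SV] by blast
      moreover from this have "{#b, a, b#} \<in> N.cl ?S" by (subst add_mset_commute)
      ultimately show ?thesis using aab by simp
    qed
    ultimately have "{#c, a, b#} \<in> N.cl ?S" using N.cl_subsetI[OF SV] by blast
    moreover have "{#c, a, b#} \<notin> N.cl (W F)"
      using W[of F "W F"] F ab c by (auto simp: W_def)
    ultimately have "{#a, b, b#} \<in> N.cl (insert {#c, a, b#} (W F))"
      using N.cl_exchange[of "W F"] SV by blast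
    \<comment> \<open>\<open>insert c F\<close> still has fewer than \<open>r\<close> elements,
      since \<open>card F + 2 = r\<close>.\<close>
    moreover have "N.cl (insert {#c, a, b#} (W F)) \<subseteq> W (insert c F)"
      using F ab c finF by (intro W) (auto simp: W_def in3)
    ultimately show False using ab c by (auto simp: W_def)
  qed
  have cardBX: "card (B - X) + card X = r" if "X \<subseteq> B" for X
    using that B finB card_Diff_subset[of X B] finite_subset[of X B] card_mono[of B X] by simp
  \<comment> \<open>Independence is built up from square-free words to cubes: a word \<open>\<alpha>\<close> is separated from the
    words already treated by the flat \<open>W (B - set_mset \<alpha>)\<close>, up to the pair \<open>a\<^sup>2b\<close>, \<open>ab\<^sup>2\<close> handled by \<open>key\<close>.\<close>
  define D\<^sub>3 where "D\<^sub>3 = mset_set ` {A. A \<subseteq> B \<and> card A = 3}"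
  define D\<^sub>2 where "D\<^sub>2 = {{#a, a, b#} | a b. a \<in> B \<and> b \<in> B \<and> a \<noteq> b}"
  define D\<^sub>1 where "D\<^sub>1 = {{#a, a, a#} | a. a \<in> B}"
  have "D\<^sub>3 \<subseteq> Sym 3 B" "D\<^sub>2 \<subseteq> Sym 3 B" "D\<^sub>1 \<subseteq> Sym 3 B"
    using finite_subset[OF _ finB] by (auto simp: D\<^sub>3_def D\<^sub>2_def D\<^sub>1_def Sym_def)
  then have sub: "D\<^sub>3 \<subseteq> Sym 3 V" "D\<^sub>2 \<subseteq> Sym 3 V" "D\<^sub>1 \<subseteq> Sym 3 V" using SBV by auto
  have D3_set: "set_mset \<alpha> \<subseteq> B \<and> card (set_mset \<alpha>) = 3" if "\<alpha> \<in> D\<^sub>3" for \<alpha>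
    using that finite_subset[OF _ finB] by (auto simp: D\<^sub>3_def)
  have D3_eq: "\<alpha> = \<beta>" if "\<alpha> \<in> D\<^sub>3" "\<beta> \<in> D\<^sub>3" "set_mset \<alpha> = set_mset \<beta>" for \<alpha> \<beta>
    using that finite_subset[OF _ finB] by (auto simp: D\<^sub>3_def)
  have "N ({} \<union> D\<^sub>3)"
  proof (rule N.indep_UnI[OF N.indep_empty sub(1)])
    fix \<alpha> assume \<alpha>: "\<alpha> \<in> D\<^sub>3"
    let ?F = "B - set_mset \<alpha>"
    have "{} \<union> D\<^sub>3 - {\<alpha>} \<subseteq> W ?F"
    proof
      fix \<beta> assume \<beta>: "\<beta> \<in> {} \<union> D\<^sub>3 - {\<alpha>}"
      \<comment> \<open>Distinct supports of size 3 are incomparable, so \<open>\<beta>\<close> has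
        a letter in \<open>?F\<close>.\<close>
      have "\<not> set_mset \<beta> \<subseteq> set_mset \<alpha>"
        using D3_set[OF \<alpha>] D3_set[of \<beta>] D3_eq[of \<beta> \<alpha>] \<beta> \<alpha>
          card_subset_eq[of "set_mset \<alpha>" "set_mset \<beta>"] by auto
      then show "\<beta> \<in> W ?F" using \<beta> D3_set[of \<beta>] sub by (auto simp: W_def)
    qed
    then have "N.cl ({} \<union> D\<^sub>3 - {\<alpha>}) \<subseteq> W ?F"
      using cardBX[of "set_mset \<alpha>"] D3_set[OF \<alpha>] B(1) by (intro W) auto
    then show "\<alpha> \<notin> N.cl ({} \<union> D\<^sub>3 - {\<alpha>})" by (auto simp: W_def)
  qed
  then have "N (({} \<union> D\<^sub>3) \<union> D\<^sub>2)"
  proof (rule N.indep_UnI[OF _ sub(2)])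
    fix \<alpha> assume "\<alpha> \<in> D\<^sub>2"
    then obtain a b where ab: "\<alpha> = {#a, a, b#}" "a \<in> B" "b \<in> B" "a \<noteq> b" by (auto simp: D\<^sub>2_def)
    let ?F = "B - {a, b}"
    \<comment> \<open>Cubes are not yet present, so \<open>ab\<^sup>2\<close> is the only other word
      with support inside \<open>{a, b}\<close>.\<close>
    have "\<beta> \<in> insert {#a, b, b#} (W ?F)" if \<beta>: "\<beta> \<in> {} \<union> D\<^sub>3 \<union> D\<^sub>2 - {\<alpha>}" for \<beta>
    proof (cases "set_mset \<beta> \<subseteq> {a, b}")
      case True
      then have "\<beta> \<notin> D\<^sub>3" using D3_set[of \<beta>] card_mono[of "{a, b}" "set_mset \<beta>"] ab(4) by auto
      then obtain c d where cd: "\<beta> = {#c, c, d#}" "c \<noteq> d" using \<beta> by (auto simp: D\<^sub>2_def)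
      then have "c = a \<and> d = b \<or> c = b \<and> d = a" using True by auto
      moreover have "{#b, b, a#} = {#a, b, b#}" by (simp add: add_mset_commute)
      ultimately show ?thesis using cd(1) ab(1) \<beta> by blast
    next
      case False
      moreover have "set_mset \<beta> \<subseteq> B" using \<beta> D3_set[of \<beta>] by (auto simp: D\<^sub>2_def)
      ultimately show ?thesis using \<beta> sub by (auto simp: W_def)
    qed
    then have "N.cl (({} \<union> D\<^sub>3) \<union> D\<^sub>2 - {\<alpha>}) \<subseteq> N.cl (insert {#a, b, b#} (W ?F))"
      using ab B by (intro N.cl_mono) (auto simp: W_def in3)
    moreover have "{#a, a, b#} \<notin> N.cl (insert {#a, b, b#} (W ?F))"
      using ab B cardBX[of "{a, b}"] by (intro key) auto
    ultimately show "\<alpha> \<notin> N.cl (({} \<union> D\<^sub>3) \<union> D\<^sub>2 - {\<alpha>})" using ab by blast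
  qed
  then have "N ((({} \<union> D\<^sub>3) \<union> D\<^sub>2) \<union> D\<^sub>1)"
  proof (rule N.indep_UnI[OF _ sub(3)])
    fix \<alpha> assume "\<alpha> \<in> D\<^sub>1"
    then obtain a where a: "\<alpha> = {#a, a, a#}" "a \<in> B" by (auto simp: D\<^sub>1_def)
    let ?F = "B - {a}"
    have "\<beta> \<in> W ?F" if \<beta>: "\<beta> \<in> {} \<union> D\<^sub>3 \<union> D\<^sub>2 \<union> D\<^sub>1 - {\<alpha>}" for \<beta>
    proof (cases "set_mset \<beta> \<subseteq> {a}")
      case True
      then have "\<beta> \<notin> D\<^sub>3" using D3_set[of \<beta>] card_mono[of "{a}" "set_mset \<beta>"] by auto
      then show ?thesis using True \<beta> a by (auto simp: D\<^sub>2_def D\<^sub>1_def)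
    next
      case False
      moreover have "set_mset \<beta> \<subseteq> B" using \<beta> D3_set[of \<beta>] by (auto simp: D\<^sub>2_def D\<^sub>1_def)
      ultimately show ?thesis using \<beta> sub by (auto simp: W_def)
    qed
    then have "N.cl ((({} \<union> D\<^sub>3) \<union> D\<^sub>2) \<union> D\<^sub>1 - {\<alpha>}) \<subseteq> W ?F"
      using cardBX[of "{a}"] a B(1) by (intro W) auto
    then show "\<alpha> \<notin> N.cl ((({} \<union> D\<^sub>3) \<union> D\<^sub>2) \<union> D\<^sub>1 - {\<alpha>})" using a by (auto simp: W_def)
  qed
  moreover have "Sym 3 B \<subseteq> (({} \<union> D\<^sub>3) \<union> D\<^sub>2) \<union> D\<^sub>1"
  proof
    fix \<alpha> assume \<alpha>: "\<alpha> \<in> Sym 3 B"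
    then obtain x y z where xyz: "\<alpha> = {#x, y, z#}" "x \<in> B" "y \<in> B" "z \<in> B"
      by (rule Sym_3E)
    have pair: "{#u, u, v#} \<in> D\<^sub>2 \<union> D\<^sub>1" if "u \<in> B" "v \<in> B" for u v
      using that by (cases "u = v") (auto simp: D\<^sub>2_def D\<^sub>1_def)
    have perm: "{#x, y, y#} = {#y, y, x#}" "{#x, y, x#} = {#x, x, y#}"
      by (simp_all add: add_mset_commute)
    consider "x = y" | "y = z" | "x = z" | "x \<noteq> y" "y \<noteq> z" "x \<noteq> z" by blast
    then show "\<alpha> \<in> (({} \<union> D\<^sub>3) \<union> D\<^sub>2) \<union> D\<^sub>1"
    proof cases
      case 1 then show ?thesis using pair[of x z] xyz by blast
    next
      case 2
      then have "\<alpha> = {#y, y, x#}" using xyz(1) perm(1) by simp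
      then show ?thesis using pair[of y x] xyz by blast
    next
      case 3
      then have "\<alpha> = {#x, x, y#}" using xyz(1) perm(2) by simp
      then show ?thesis using pair[of x y] xyz by blast
    next
      case 4
      then have "\<alpha> = mset_set {x, y, z}" using xyz by simp
      then show ?thesis using 4 xyz by (auto simp: D\<^sub>3_def intro!: image_eqI[of _ _ "{x, y, z}"])
    qed
  qed
  ultimately show ?thesis using N.indep_subset by blast
qed

end

subsection \<open>Matroids of real functions\<close>

text \<open>Linear independence on \<open>P\<close> of an indexed family, not of a set of functions:
  distinct elements with equal functions must be dependent.\<close>

definition function_indep :: "'e set \<Rightarrow> 'x set \<Rightarrow> ('e \<Rightarrow> 'x \<Rightarrow> real) \<Rightarrow> 'e set \<Rightarrow> bool" where
  "function_indep E P \<phi> X \<longleftrightarrow> X \<subseteq> E \<and>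
     (\<forall>c. (\<forall>p\<in>P. (\<Sum>e\<in>X. c e * \<phi> e p) = 0) \<longrightarrow> (\<forall>e\<in>X. c e = 0))"

interpretation fun_space: vector_space "\<lambda>(c::real) (f::'x \<Rightarrow> real) x. c * f x"
  by unfold_locales (auto simp: fun_eq_iff algebra_simps)

lemma sum_fun_apply: "(\<Sum>i\<in>I. f i) x = (\<Sum>i\<in>I. f i x)"
  by (induction I rule: infinite_finite_induct) auto

text \<open>Functions set to 0 outside \<open>P\<close> live in one vector space of total functions,
  with equality meaning equality on \<open>P\<close>; \<open>inj_on\<close> accounts for elements
  with the same function.\<close>

lemma function_indep_iff_independent:
  assumes "finite E"
  defines "\<psi> \<equiv> \<lambda>\<phi> P e p. if p \<in> P then \<phi> e p else 0"
  shows "function_indep E P \<phi> X \<longleftrightarrow>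
     X \<subseteq> E \<and> inj_on (\<psi> \<phi> P) X \<and> fun_space.independent (\<psi> \<phi> P ` X)"
proof (cases "X \<subseteq> E")
  case True
  then have fin: "finite X" using assms(1) finite_subset by blast
  let ?\<psi> = "\<psi> \<phi> P"
  have zero: "(\<forall>p\<in>P. (\<Sum>e\<in>X. c e * \<phi> e p) = 0) \<longleftrightarrow> (\<Sum>e\<in>X. (\<lambda>p. c e * ?\<psi> e p)) = 0" for c
  proof -
    have "(\<Sum>e\<in>X. c e * ?\<psi> e p) = (if p \<in> P then \<Sum>e\<in>X. c e * \<phi> e p else 0)" for p
      by (simp add: \<psi>_def)
    then show ?thesis unfolding fun_eq_iff sum_fun_apply by (auto split: if_splits)
  qed
  show ?thesis unfolding function_indep_def zero
  proof safe
    assume *: "\<forall>c. (\<Sum>e\<in>X. (\<lambda>p. c e * ?\<psi> e p)) = 0 \<longrightarrow> (\<forall>e\<in>X. c e = 0)"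
    show inj: "inj_on ?\<psi> X"
    proof (rule inj_onI, rule ccontr)
      fix e f assume ef: "e \<in> X" "f \<in> X" "?\<psi> e = ?\<psi> f" "e \<noteq> f"
      define c where "c g = (if g = e then 1 else if g = f then -1 else 0 :: real)" for g
      have "X = insert e (insert f (X - {e, f}))" using ef by auto
      then have "(\<Sum>g\<in>X. c g * ?\<psi> g p) = (\<Sum>g\<in>insert e (insert f (X - {e, f})). c g * ?\<psi> g p)" for p
        by simp
      also have "\<dots> p = 0" for p using ef fin by (simp add: c_def)
      finally have "(\<Sum>g\<in>X. (\<lambda>p. c g * ?\<psi> g p)) = 0" by (auto simp: fun_eq_iff sum_fun_apply)
      then have "c e = 0" using * ef by blast
      then show False by (simp add: c_def)
    qed
    assume "fun_space.dependent (?\<psi> ` X)"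
    then obtain u v where u: "v \<in> ?\<psi> ` X" "u v \<noteq> 0" "(\<Sum>v\<in>?\<psi> ` X. (\<lambda>p. u v * v p)) = 0"
      using fun_space.dependent_finite[of "?\<psi> ` X"] fin by auto
    then have "(\<Sum>e\<in>X. (\<lambda>p. u (?\<psi> e) * ?\<psi> e p)) = 0" by (simp add: sum.reindex[OF inj])
    then show False using * u by auto
  next
    fix c e assume inj: "inj_on ?\<psi> X" and indep: "fun_space.independent (?\<psi> ` X)"
      and c: "(\<Sum>e\<in>X. (\<lambda>p. c e * ?\<psi> e p)) = 0" and e: "e \<in> X"
    have "(\<Sum>v\<in>?\<psi> ` X. (\<lambda>p. c (the_inv_into X ?\<psi> v) * v p)) = 0"
      using c by (simp add: sum.reindex[OF inj] the_inv_into_f_f[OF inj] cong: sum.cong)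
    then have "c (the_inv_into X ?\<psi> (?\<psi> e)) = 0"
      using fun_space.independentD[OF indep, of "?\<psi> ` X"
          "\<lambda>v. c (the_inv_into X ?\<psi> v)" "?\<psi> e"] fin e by simp
    then show "c e = 0" using e by (simp add: the_inv_into_f_f[OF inj])
  qed
qed (simp add: function_indep_def)

text \<open>Augmentation is the Steinitz bound: a larger independent family cannot lie in the span
  of a smaller one.\<close>

lemma matroid_function_indep:
  assumes "finite E"
  shows "matroid E (function_indep E P \<phi>)"
proof -
  define \<psi> where "\<psi> e p = (if p \<in> P then \<phi> e p else 0)" for e p
  have iff: "function_indep E P \<phi> X \<longleftrightarrow>
      X \<subseteq> E \<and> inj_on \<psi> X \<and> fun_space.independent (\<psi> ` X)" for X
    unfolding function_indep_iff_independent[OF assms] \<psi>_def [abs_def] ..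
  show ?thesis
  proof
    fix X Y assume X: "function_indep E P \<phi> X" and Y: "function_indep E P \<phi> Y"
      and card: "card X < card Y"
    have fin: "finite X" "finite Y" using X Y assms finite_subset by (auto simp: iff)
    have "\<exists>y\<in>Y. \<psi> y \<notin> fun_space.span (\<psi> ` X)"
    proof (rule ccontr)
      assume "\<not> ?thesis"
      then have "\<psi> ` Y \<subseteq> fun_space.span (\<psi> ` X)" by blast
      then have "card (\<psi> ` Y) \<le> card (\<psi> ` X)"
        using fun_space.independent_span_bound[of "\<psi> ` X" "\<psi> ` Y"] Y fin by (simp add: iff)
      then show False using X Y card by (simp add: iff card_image)
    qed
    then obtain y where y: "y \<in> Y" "\<psi> y \<notin> fun_space.span (\<psi> ` X)" by blast
    then have "\<psi> y \<notin> \<psi> ` X" using fun_space.span_base by blast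
    then show "\<exists>y\<in>Y - X. function_indep E P \<phi> (insert y X)"
      using X Y y fun_space.independent_insertI[OF y(2)]
      by (intro bexI[of _ y]) (auto simp: iff)
  next
    fix X Y assume "function_indep E P \<phi> X" "Y \<subseteq> X"
    then show "function_indep E P \<phi> Y"
      using fun_space.independent_mono[of "\<psi> ` X" "\<psi> ` Y"] inj_on_subset[of \<psi> X Y]
      by (auto simp: iff)
  qed (use assms in \<open>auto simp: iff fun_space.independent_empty\<close>)
qed

text \<open>At the point \<open>p\<close> a relation on \<open>insert e I\<close> reduces to its
  \<open>e\<close> term, so the coefficient of \<open>e\<close> is 0.\<close>

lemma flat_function_indep:
  assumes "finite E" "F \<subseteq> E"
    and sep: "\<And>e. e \<in> E - F \<Longrightarrow> \<exists>p\<in>P. \<phi> e p \<noteq> 0 \<and> (\<forall>f\<in>F. \<phi> f p = 0)"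
  shows "flat E (function_indep E P \<phi>) F"
  unfolding flat_def
proof (intro conjI ballI)
  interpret matroid E "function_indep E P \<phi>" by (rule matroid_function_indep) fact
  fix e assume e: "e \<in> E - F"
  obtain I where I: "I \<subseteq> F" "function_indep E P \<phi> I"
      "card I = rank_of (function_indep E P \<phi>) F"
    using obtain_basis[OF \<open>F \<subseteq> E\<close>] .
  have eI: "e \<notin> I" "finite I" using e I finite_indep by auto
  obtain p where p: "p \<in> P" "\<phi> e p \<noteq> 0" "\<forall>f\<in>F. \<phi> f p = 0" using sep[OF e] by blast
  have "function_indep E P \<phi> (insert e I)"
    unfolding function_indep_def
  proof (intro conjI allI impI)
    show "insert e I \<subseteq> E" using e I assms by auto
    fix c assume c: "\<forall>p\<in>P. (\<Sum>f\<in>insert e I. c f * \<phi> f p) = 0"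
    have "(\<Sum>f\<in>I. c f * \<phi> f p) = 0" using p I by (intro sum.neutral) auto
    then have "c e = 0" using c p eI by auto
    moreover from this have "\<forall>p\<in>P. (\<Sum>f\<in>I. c f * \<phi> f p) = 0" using c eI by auto
    then have "\<forall>f\<in>I. c f = 0" using I(2) unfolding function_indep_def by blast
    ultimately show "\<forall>f\<in>insert e I. c f = 0" by simp
  qed
  then have "card (insert e I) \<le> rank_of (function_indep E P \<phi>) (insert e F)"
    using card_le_rank_of[of "insert e F" "insert e I"] e I assms by blast
  then show "rank_of (function_indep E P \<phi>) F < rank_of (function_indep E P \<phi>) (insert e F)"
    using eI I by simp
qed fact

subsection \<open>The quartic counterexample\<close>

text \<open>The quartic \<open>x\<^sub>a\<^sup>3x\<^sub>b - x\<^sub>ax\<^sub>b\<^sup>3\<close> splits into linear factors, and its zero set on the hyperplane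
  \<open>\<Sum>x\<^sub>v = 0\<close> still contains points of every support of size at least two.\<close>

definition quartic_points :: "'a set \<Rightarrow> 'a \<Rightarrow> 'a \<Rightarrow> ('a \<Rightarrow> real) set" where
  "quartic_points V a b = {x. (\<Sum>v\<in>V. x v) = 0 \<and> x a ^ 3 * x b = x a * x b ^ 3}"

text \<open>Put 1 on \<open>S\<close> and correct the sum at one coordinate \<open>w\<close>. With
  \<open>w\<close> outside \<open>{a, b}\<close> the values at \<open>a\<close>, \<open>b\<close>
  are 0 or 1; for \<open>S = {a, b}\<close> they are 1 and -1. Both solve the quartic.\<close>

lemma obtain_quartic_point:
  assumes "finite V" "S \<subseteq> V" "2 \<le> card S" "a \<noteq> b"
  obtains x where "x \<in> quartic_points V a b" "\<And>v. x v \<noteq> 0 \<longleftrightarrow> v \<in> S"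
proof -
  have fin: "finite S" using assms finite_subset by blast
  have "\<exists>w\<in>S. S = {a, b} \<or> w \<notin> {a, b}"
  proof (cases "S \<subseteq> {a, b}")
    case True
    then show ?thesis using card_seteq[of "{a, b}" S] assms by auto
  qed auto
  then obtain w where w: "w \<in> S" "S = {a, b} \<or> w \<notin> {a, b}" by blast
  \<comment> \<open>\<open>1 - card S\<close> cancels the other ones and is nonzero as
    \<open>2 \<le> card S\<close>.\<close>
  define x where "x v = (if v = w then 1 - real (card S) else of_bool (v \<in> S))" for v
  have "(\<Sum>v\<in>V. x v) = (\<Sum>v\<in>S. x v)"
    using assms(1,2) w by (intro sum.mono_neutral_right) (auto simp: x_def)
  also have "\<dots> = x w + (\<Sum>v\<in>S - {w}. x v)"
    using w fin by (simp add: sum.remove)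
  also have "(\<Sum>v\<in>S - {w}. x v) = (\<Sum>v\<in>S - {w}. 1)" by (rule sum.cong) (auto simp: x_def)
  also have "\<dots> = real (card S) - 1" using w fin assms(3) by (simp add: of_nat_diff)
  finally have "(\<Sum>v\<in>V. x v) = 0" by (simp add: x_def)
  moreover have "x a ^ 3 * x b = x a * x b ^ 3"
    using w assms(4) by (auto simp: x_def)
  moreover have "x v \<noteq> 0 \<longleftrightarrow> v \<in> S" for v using w assms(3) by (auto simp: x_def)
  ultimately show thesis using that[of x] by (simp add: quartic_points_def)
qed

text \<open>Points of full support span the hyperplane, so only multiples of the coordinate sum
  vanish on them; four test points per letter \<open>u\<close> show this.\<close>

lemma relation_on_quartic_points:
  fixes c :: "'a \<Rightarrow> real"
  assumes V: "finite V" "4 \<le> card V" "a \<in> V" "b \<in> V" "a \<noteq> b"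
    and rel: "\<And>x. x \<in> quartic_points V a b \<Longrightarrow> (\<forall>v\<in>V. x v \<noteq> 0) \<Longrightarrow> (\<Sum>v\<in>V. c v * x v) = 0"
  obtains t where "\<And>v. v \<in> V \<Longrightarrow> c v = t"
proof -
  have "card (V - {a, b}) \<ge> 2" using V by (simp add: card_Diff_subset)
  then have "\<exists>w. w \<in> V - {a, b}" by (metis card.empty not_numeral_le_zero ex_in_conv)
  then obtain w where w: "w \<in> V - {a, b}" by blast
  have all: "c a = c w \<and> c b = c w \<and> c u = c w" if u: "u \<in> V - {a, b, w}" for u
  proof -
    define R where "R = V - {a, b, u, w}"
    have VR: "V = insert a (insert b (insert u (insert w R)))" using V w u by (auto simp: R_def)
    have R: "a \<notin> R" "b \<notin> R" "u \<notin> R" "w \<notin> R" "finite R" using V by (auto simp: R_def)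
    have ne: "a \<noteq> u" "b \<noteq> u" "a \<noteq> w" "b \<noteq> w" "u \<noteq> w" using u w by auto
    define s where "s = real (card R)"
    \<comment> \<open>The test points are 1 on \<open>R\<close> and balanced at \<open>w\<close>.
      The condition on squares puts them on the quartic; positivity keeps the value at
      \<open>w\<close> nonzero.\<close>
    have eq: "c a * \<alpha> + c b * \<beta> + c u * \<gamma> + (\<Sum>v\<in>R. c v) = c w * (\<alpha> + \<beta> + \<gamma> + s)"
      if h: "\<alpha>\<^sup>2 = \<beta>\<^sup>2" "\<alpha> \<noteq> 0" "\<beta> \<noteq> 0" "\<gamma> \<noteq> 0" "\<alpha> + \<beta> + \<gamma> > 0" for \<alpha> \<beta> \<gamma>
    proof -
      define x where "x = (\<lambda>_. 1)(a := \<alpha>, b := \<beta>, u := \<gamma>, w := - (\<alpha> + \<beta> + \<gamma> + s))"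
      have xR: "\<And>v. v \<in> R \<Longrightarrow> x v = 1" using R by (auto simp: x_def)
      have xs: "x a = \<alpha>" "x b = \<beta>" "x u = \<gamma>" "x w = - (\<alpha> + \<beta> + \<gamma> + s)"
        using ne V(5) by (auto simp: x_def)
      have "(\<Sum>v\<in>R. x v) = s" "(\<Sum>v\<in>R. c v * x v) = (\<Sum>v\<in>R. c v)" by (auto simp: xR s_def)
      note sums = this
      have "\<alpha> ^ 3 * \<beta> = \<alpha> * \<beta> ^ 3" using h(1) by (simp add: power3_eq_cube power2_eq_square)
      moreover have "(\<Sum>v\<in>V. x v) = 0" unfolding VR using R ne V(5) by (simp add: xs sums)
      ultimately have "x \<in> quartic_points V a b" by (simp add: quartic_points_def xs)
      moreover have "s \<ge> 0" by (simp add: s_def)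
      then have "\<forall>v\<in>V. x v \<noteq> 0" using h by (auto simp: VR xR xs)
      ultimately have "(\<Sum>v\<in>V. c v * x v) = 0" by (rule rel)
      then show ?thesis unfolding VR using R ne V(5) by (simp add: xs sums algebra_simps)
    qed
    show ?thesis
      \<comment> \<open>The first two choices differ in \<open>\<gamma>\<close> and give
        \<open>c u = c w\<close>; a sign change at \<open>\<beta>\<close> or \<open>\<alpha>\<close>
        compares \<open>c b\<close> or \<open>c a\<close> with \<open>c w\<close>.\<close>
      using eq[of 1 1 1] eq[of 1 1 2] eq[of 1 "-1" 1] eq[of "-1" 1 1] by (simp add: algebra_simps)
  qed
  have "\<exists>u. u \<in> V - {a, b, w}"
  proof -
    have "\<not> V \<subseteq> {a, b, w}" using V w card_mono[of "{a, b, w}" V] by (auto simp: card_insert_if)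
    then show ?thesis by blast
  qed
  then have "c v = c w" if "v \<in> V" for v using all that by blast
  then show thesis using that by blast
qed

text \<open>Here \<open>V\<close> is a circuit, so \<open>M\<close> is the matroid of coordinate
  functions on the hyperplane; \<open>N\<close> is the matroid of the monomials of degree 4 on
  \<open>quartic_points\<close>.\<close>

lemma uniform_quartic_counterexample:
  assumes V: "finite V" and uniform: "\<And>X. M X \<longleftrightarrow> X \<subseteq> V \<and> card X \<le> r"
    and r: "3 \<le> r" "card V = Suc r"
  shows "\<exists>N. matroid (Sym 4 V) N \<and> flat_property 4 V M N \<and> multilinearity 4 V M N \<and>
    \<not> SP_rank_property 4 V M N"
proof -
  \<comment> \<open>\<open>w\<close> will be left out of the basis \<open>B\<close>, which has to
    contain \<open>a\<close> and \<open>b\<close>.\<close>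
  obtain T where T: "T \<subseteq> V" "card T = 3" using obtain_subset_with_card_n[of 3 V] r by auto
  then obtain a b w where "T = {a, b, w}" "a \<noteq> b" "a \<noteq> w" "b \<noteq> w" by (auto simp: card_3_iff)
  then have ab: "a \<in> V" "b \<in> V" "w \<in> V" "a \<noteq> b" "w \<noteq> a" "w \<noteq> b" using T by auto
  define P where "P = quartic_points V a b"
  define \<phi> where "\<phi> \<alpha> x = (\<Prod>v\<in>#\<alpha>. x v)" for \<alpha> :: "'a multiset" and x :: "'a \<Rightarrow> real"
  let ?N = "function_indep (Sym 4 V) P \<phi>"
  have finS: "finite (Sym 4 V)" using V by (rule finite_Sym)
  have \<phi>_add: "\<phi> (add_mset v \<tau>) x = x v * \<phi> \<tau> x" for v \<tau> x by (simp add: \<phi>_def)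
  have \<phi>_zero: "\<phi> \<alpha> x = 0 \<longleftrightarrow> (\<exists>v\<in>#\<alpha>. x v = 0)" for \<alpha> x by (auto simp: \<phi>_def)
  have N: "matroid (Sym 4 V) ?N" using finS by (rule matroid_function_indep)
  have flat: "flat_property 4 V M ?N"
    unfolding flat_property_def
  proof (intro allI impI)
    fix F assume "flat V M F"
    then consider "F = V" | "F \<subseteq> V" "card F < r" using uniform_flatD[OF V uniform] by blast
    then show "flat (Sym 4 V) ?N (concat_words (words1 F) (Sym (4 - 1) V))"
    proof cases
      case 1
      have "set_mset \<alpha> \<inter> V \<noteq> {}" if "\<alpha> \<in> Sym 4 V" for \<alpha> using that by (auto simp: Sym_def Int_absorb2)
      then have "concat_words (words1 F) (Sym (4 - 1) V) = Sym 4 V"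
        using concat_words1_Sym[of F V 3] 1 by auto
      then show ?thesis by (simp add: flat_def)
    next
      case 2
      have FV: "concat_words (words1 F) (Sym (4 - 1) V) = {\<alpha> \<in> Sym 4 V. set_mset \<alpha> \<inter> F \<noteq> {}}"
        using concat_words1_Sym[OF 2(1), of 3] by simp
      \<comment> \<open>As \<open>card V = Suc r\<close>, at least two letters lie outside
        \<open>F\<close>, which makes a point with support \<open>V - F\<close> available.\<close>
      have "2 \<le> card (V - F)" using 2 r V finite_subset[of F V] by (simp add: card_Diff_subset)
      then obtain x where x: "x \<in> P" "\<And>v. x v \<noteq> 0 \<longleftrightarrow> v \<in> V - F"
        using obtain_quartic_point[OF V Diff_subset _ ab(4)] unfolding P_def by blast
      show ?thesis unfolding FV
      proof (rule flat_function_indep[OF finS])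
        fix \<alpha> assume "\<alpha> \<in> Sym 4 V - {\<alpha> \<in> Sym 4 V. set_mset \<alpha> \<inter> F \<noteq> {}}"
        then have "\<phi> \<alpha> x \<noteq> 0" using x(2) by (auto simp: \<phi>_zero Sym_def)
        moreover have "\<phi> \<beta> x = 0" if "set_mset \<beta> \<inter> F \<noteq> {}" for \<beta>
          using that x(2) by (auto simp: \<phi>_zero)
        ultimately show "\<exists>x\<in>P. \<phi> \<alpha> x \<noteq> 0 \<and>
            (\<forall>\<beta>\<in>{\<alpha> \<in> Sym 4 V. set_mset \<alpha> \<inter> F \<noteq> {}}. \<phi> \<beta> x = 0)"
          using x(1) by blast
      qed auto
    qed
  qed
  have restr: "?N ((\<lambda>v. add_mset v \<tau>) ` Y) \<longleftrightarrow> M Y"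
    if \<tau>: "\<tau> \<in> Sym 3 V" and Y: "Y \<subseteq> V" for \<tau> Y
  proof -
    have inj: "inj_on (\<lambda>v. add_mset v \<tau>) Y" by (auto simp: inj_on_def)
    have sum: "(\<Sum>\<alpha>\<in>(\<lambda>v. add_mset v \<tau>) ` Y. c \<alpha> * \<phi> \<alpha> x) =
        \<phi> \<tau> x * (\<Sum>v\<in>Y. c (add_mset v \<tau>) * x v)" for c x
      by (simp add: sum.reindex[OF inj] \<phi>_add sum_distrib_left mult_ac)
    have sub: "(\<lambda>v. add_mset v \<tau>) ` Y \<subseteq> Sym 4 V"
      using \<tau> Y by (auto simp: Sym_def)
    show ?thesis
    proof
      assume N: "?N ((\<lambda>v. add_mset v \<tau>) ` Y)"
      show "M Y"
      proof (rule ccontr)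
        assume "\<not> M Y"
        then have "card V \<le> card Y" using Y r uniform by auto
        then have "Y = V" using card_seteq[OF V Y] by simp
        \<comment> \<open>The hyperplane equation multiplied by \<open>\<tau>\<close> is a relation
          with all coefficients 1.\<close>
        then have "\<forall>x\<in>P. (\<Sum>\<alpha>\<in>(\<lambda>v. add_mset v \<tau>) ` Y. 1 * \<phi> \<alpha> x) = 0"
          unfolding sum by (simp add: P_def quartic_points_def)
        then have "\<forall>\<alpha>\<in>(\<lambda>v. add_mset v \<tau>) ` Y. (1::real) = 0"
          using N unfolding function_indep_def by (elim conjE allE[of _ "\<lambda>_. 1"]) blast
        then show False using \<open>Y = V\<close> ab(1) by auto
      qed
    next
      assume "M Y"
      then have "Y \<noteq> V" using uniform r(2) by auto
      then obtain v\<^sub>0 where v0: "v\<^sub>0 \<in> V" "v\<^sub>0 \<notin> Y" using Y by blast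
      have "c (add_mset v \<tau>) = 0"
        if c: "\<forall>x\<in>P. (\<Sum>\<alpha>\<in>(\<lambda>v. add_mset v \<tau>) ` Y. c \<alpha> * \<phi> \<alpha> x) = 0" and v: "v \<in> Y" for c v
      proof -
        \<comment> \<open>Extended by 0, the coefficients are constant on \<open>V\<close> and
          vanish at \<open>v\<^sub>0\<close>, hence everywhere.\<close>
        define d where "d u = (if u \<in> Y then c (add_mset u \<tau>) else 0)" for u
        have "(\<Sum>u\<in>V. d u * x u) = 0" if x: "x \<in> quartic_points V a b" "\<forall>u\<in>V. x u \<noteq> 0" for x
        proof -
          \<comment> \<open>On full support the common factor \<open>\<phi> \<tau> x\<close>
            cancels.\<close>
          have "\<phi> \<tau> x \<noteq> 0" using x(2) \<tau> by (auto simp: \<phi>_zero Sym_def)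
          then have "(\<Sum>u\<in>Y. c (add_mset u \<tau>) * x u) = 0" using c x(1) unfolding sum P_def by auto
          moreover have "(\<Sum>u\<in>V. d u * x u) = (\<Sum>u\<in>Y. c (add_mset u \<tau>) * x u)"
            using V Y by (intro sum.mono_neutral_cong_right) (auto simp: d_def)
          ultimately show ?thesis by simp
        qed
        then obtain t where "\<And>u. u \<in> V \<Longrightarrow> d u = t"
          using relation_on_quartic_points[OF V _ ab(1,2,4), of d] r by auto
        then have "d v = d v\<^sub>0" using v v0 Y by auto
        then show ?thesis using v v0 by (simp add: d_def)
      qed
      then show "?N ((\<lambda>v. add_mset v \<tau>) ` Y)" using sub unfolding function_indep_def by blast
    qed
  qed
  have "loops V M = {}" using uniform_loops[OF V uniform] r(1) by auto
  then have mult: "multilinearity 4 V M ?N"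
    using restr by (simp add: multilinearity_iff)
  define B where "B = V - {w}"
  have B: "B \<subseteq> V" "card B = r" using ab V r by (auto simp: B_def)
  have basis: "M B" "\<And>v. v \<in> V - B \<Longrightarrow> \<not> M (insert v B)"
    using B uniform finite_subset[OF B(1) V] by auto
  have "\<not> ?N (Sym 4 B)"
  proof
    let ?X = "{{#a, a, a, b#}, {#a, b, b, b#}}"
    \<comment> \<open>With these coefficients the relation is the equation of the quartic.\<close>
    define c where "c \<alpha> = (if \<alpha> = {#a, a, a, b#} then 1 else - 1 :: real)" for \<alpha>
    have "count {#a, a, a, b#} a \<noteq> count {#a, b, b, b#} a" using ab(4) by simp
    then have ne: "{#a, a, a, b#} \<noteq> {#a, b, b, b#}" by metis
    assume "?N (Sym 4 B)"
    then have "?N ?X" using matroid.indep_subset[OF N, of "Sym 4 B" ?X] ab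
      by (auto simp: Sym_def B_def)
    moreover have "(\<Sum>\<alpha>\<in>?X. c \<alpha> * \<phi> \<alpha> x) = 0" if "x \<in> P" for x
      using that ne ab(4)
      by (simp add: c_def \<phi>_def P_def quartic_points_def power3_eq_cube mult_ac)
    ultimately have "c {#a, a, a, b#} = 0" unfolding function_indep_def by blast
    then show False by (simp add: c_def)
  qed
  then have "rank_of ?N (Sym 4 B) < card (Sym 4 B)"
    using matroid.rank_of_less_card[OF N] Sym_mono[OF B(1)] by blast
  then have "\<not> SP_rank_property 4 V M ?N"
    using rank_eq_rank_of_Sym_basis[OF N _ mult B(1) basis] B
      card_Sym[OF finite_subset[OF B(1) V], of 4] uniform_matroid_rank[OF V uniform B]
    by (simp add: SP_rank_property_def)
  then show ?thesis using N flat mult by blast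
qed

text \<open>Part (b) is stated for circuits of rank at least 3. In rank 0 or 1 the two properties
  force the SP-rank Property, so some lower bound on the rank is unavoidable.\<close>

theorem theorem2p5:
  fixes V :: "'a set" and M :: "'a set \<Rightarrow> bool"
  assumes "uniform_matroid V M"
    and "\<not> free_matroid V M"
  shows "(\<forall>N. matroid (Sym 3 V) N \<and> flat_property 3 V M N \<and> multilinearity 3 V M N
              \<longrightarrow> SP_rank_property 3 V M N) \<and>
         (3 \<le> matroid_rank V M \<and> card V = matroid_rank V M + 1 \<longrightarrow>
            (\<exists>N. matroid (Sym 4 V) N \<and> flat_property 4 V M N \<and> multilinearity 4 V M N \<and>
                 \<not> SP_rank_property 4 V M N))"
proof -
  obtain r where M: "matroid V M" and uniform: "\<And>X. M X \<longleftrightarrow> X \<subseteq> V \<and> card X \<le> r"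
    using assms(1) unfolding uniform_matroid_def by blast
  have V: "finite V" using M by (rule matroid.finite_carrier)
  have r: "r < card V" using assms(2) M uniform by (auto simp: free_matroid_def)
  then obtain B where B: "B \<subseteq> V" "card B = r"
    using obtain_subset_with_card_n[of r V] by (metis less_imp_le)
  have finB: "finite B" using B V finite_subset by blast
  have basis: "M B" "\<And>v. v \<in> V - B \<Longrightarrow> \<not> M (insert v B)" using B uniform finB by auto
  have rank: "matroid_rank V M = r" using uniform_matroid_rank[OF V uniform B] .
  have "SP_rank_property 3 V M N"
    if N: "matroid (Sym 3 V) N" and "flat_property 3 V M N"
      and mult: "multilinearity 3 V M N" for N
  proof -
    have "N (Sym 3 B)" using uniform_cubic_lower_bound[OF V uniform that B r] .
    then have "matroid_rank (Sym 3 V) N = card (Sym 3 B)"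
      using matroid.card_eq_rank_of_indep[OF N] rank_eq_rank_of_Sym_basis[OF N _ mult B(1) basis]
      by simp
    then show ?thesis using card_Sym[OF finB, of 3] rank B by (simp add: SP_rank_property_def)
  qed
  moreover have "\<exists>N. matroid (Sym 4 V) N \<and> flat_property 4 V M N \<and> multilinearity 4 V M N \<and>
      \<not> SP_rank_property 4 V M N" if "3 \<le> r" "card V = r + 1"
    using uniform_quartic_counterexample[OF V uniform that(1)] that(2) by simp
  ultimately show ?thesis unfolding rank by blast
qed

end
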